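(* Let $G=(V,E)$ be a finite simple graph with a partition $E=R\sqcup B$ of its edges into two colour classes. If \[ |E|+\min\{|R|,|B|\}\ge\binom{|V|}{2}, \] then one of the following holds: (1) $G$ has a non-monochromatic triangle (a subgraph isomorphic to $K_3$ with at least one edge in $R$ and at least one edge in $B$); (2) $G$ is a monochromatic clique, i.e. $G$ is a complete graph and $E=R$ or $E=B$; (3) $G$ is a 4-cycle and each of $R$ and $B$ is a perfect matching of $G$; (4) $G$ (with its colouring) is isomorphic to $H_m$ or to $H_m^+$ for some integer $m\ge1$.
   Context: For a positive integer $m$, the 2-edge-coloured graph $H_m$ is defined as follows: its vertex set is the disjoint union $X_0\sqcup X_1\sqcup X_2$ with $|X_0|=|X_1|=|X_2|=m$; its edges are all edges between $X_0$ and $X_1\cup X_2$, together with all edges inside $X_1$ (a clique on $X_1$) and all edges inside $X_2$ (a clique on $X_2$); there are no other edges. The colour classes are $E_1$ = all edges incident with a vertex of $X_1$ and $E_2$ = all edges incident with a vertex of $X_2$. The 2-edge-coloured graph $H_m^+$ is defined identically except that $|X_0|=m+1$. Two 2-edge-coloured graphs are isomorphic if there is a graph isomorphism between them mapping each colour class onto some colour class of the other (so the two colours may be swapped). *)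

theory Defs
  imports "HOL-Library.Ramsey"
begin

definition finite_simple_graph :: "'a set \<Rightarrow> 'a set set \<Rightarrow> bool" where
  "finite_simple_graph V E \<longleftrightarrow> finite V \<and> E \<subseteq> [V]\<^bsup>2\<^esup>"

definition complete_graph :: "'a set \<Rightarrow> 'a set set \<Rightarrow> bool" where
  "complete_graph V E \<longleftrightarrow> E = [V]\<^bsup>2\<^esup>"

definition four_cycle :: "'a set \<Rightarrow> 'a set set \<Rightarrow> bool" where
  "four_cycle V E \<longleftrightarrow>
     (\<exists>a b c d. distinct [a, b, c, d] \<and> V = {a, b, c, d} \<and>
        E = {{a, b}, {b, c}, {c, d}, {d, a}})"

definition perfect_matching :: "'a set \<Rightarrow> 'a set set \<Rightarrow> 'a set set \<Rightarrow> bool" where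
  "perfect_matching V E M \<longleftrightarrow> M \<subseteq> E \<and> (\<forall>v\<in>V. \<exists>!e. e \<in> M \<and> v \<in> e)"

definition non_monochromatic_triangle ::
    "'a set \<Rightarrow> 'a set set \<Rightarrow> 'a set set \<Rightarrow> 'a set set \<Rightarrow> bool" where
  "non_monochromatic_triangle V E R B \<longleftrightarrow>
     (\<exists>x\<in>V. \<exists>y\<in>V. \<exists>z\<in>V. distinct [x, y, z] \<and>
        {{x, y}, {y, z}, {x, z}} \<subseteq> E \<and>
        {{x, y}, {y, z}, {x, z}} \<inter> R \<noteq> {} \<and>
        {{x, y}, {y, z}, {x, z}} \<inter> B \<noteq> {})"

text \<open>A 2-edge-coloured graph is given by its vertices, its edges and its two colour classes.\<close>

type_synonym 'a coloured_graph = "'a set \<times> 'a set set \<times> 'a set set \<times> 'a set set"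

fun coloured_iso :: "'a coloured_graph \<Rightarrow> 'b coloured_graph \<Rightarrow> bool" where
  "coloured_iso (V, E, C, D) (V', E', C', D') \<longleftrightarrow>
     (\<exists>f. bij_betw f V V' \<and>
        (\<forall>x\<in>V. \<forall>y\<in>V. {x, y} \<in> E \<longleftrightarrow> {f x, f y} \<in> E') \<and>
        (((`) f ` C = C' \<and> (`) f ` D = D') \<or> ((`) f ` C = D' \<and> (`) f ` D = C')))"

definition incident_edges :: "'a set set \<Rightarrow> 'a set \<Rightarrow> 'a set set" where
  "incident_edges E X = {e \<in> E. e \<inter> X \<noteq> {}}"

definition H_edges :: "'a set \<Rightarrow> 'a set \<Rightarrow> 'a set \<Rightarrow> 'a set set" where
  "H_edges X0 X1 X2 =
     {{x, y} | x y. x \<in> X0 \<and> y \<in> X1 \<union> X2} \<union> [X1]\<^bsup>2\<^esup> \<union> [X2]\<^bsup>2\<^esup>"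

definition H_on :: "'a set \<Rightarrow> 'a set \<Rightarrow> 'a set \<Rightarrow> 'a coloured_graph" where
  "H_on X0 X1 X2 =
     (X0 \<union> X1 \<union> X2, H_edges X0 X1 X2,
      incident_edges (H_edges X0 X1 X2) X1, incident_edges (H_edges X0 X1 X2) X2)"

text \<open>
  The three disjoint parts are realised inside \<open>nat \<times> nat\<close>, tagged by the first component.
\<close>

definition part :: "nat \<Rightarrow> nat \<Rightarrow> (nat \<times> nat) set" where
  "part i k = {i} \<times> {..<k}"

definition H_graph :: "nat \<Rightarrow> (nat \<times> nat) coloured_graph" where
  "H_graph m = H_on (part 0 m) (part 1 m) (part 2 m)"

definition H_plus_graph :: "nat \<Rightarrow> (nat \<times> nat) coloured_graph" where
  "H_plus_graph m = H_on (part 0 (m + 1)) (part 1 m) (part 2 m)"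

end

theory Submission
  imports Defs
begin

text \<open>
  Write \<open>r\<close>, \<open>b\<close>, \<open>e\<close> for the numbers of red edges, blue edges and non-edges; the hypothesis says
  \<open>r - e \<ge> 0\<close> and \<open>b - e \<ge> 0\<close>. Without a non-monochromatic triangle, \<open>min (r - e) (b - e) \<le> 0\<close>
  always holds. In a minimal configuration with both quantities nonnegative every proper induced
  subgraph satisfies this bound, so deleting any small vertex set \<open>S\<close> destroys at least as many red
  edges as non-edges, or at least as many blue edges as non-edges. Applied to sets of one, two and four
  vertices this gives linear inequalities between vertex degrees. Call a vertex mixed if it
  meets both colours. Comparing a mixed vertex of largest monochromatic degree with the ends of an
  edge between two mixed vertices, the inequalities are contradictory unless the graph is the
  alternating 4-cycle. Otherwise the mixed vertices form an independent set of size \<open>k\<close>; with \<open>f\<close>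
  purely red and \<open>g\<close> purely blue vertices and \<open>g \<le> f\<close>, counting gives
  \<open>2 (b - e) \<le> - (k - g) (k - g - 1) - 2 g (f - g)\<close>, which forces \<open>f = g\<close>, \<open>k \<in> {g, g + 1}\<close> and
  tightness everywhere, that is \<open>H\<^sub>m\<close> or \<open>H\<^sub>m\<^sup>+\<close>.
\<close>

section \<open>Weights, degrees and the two extremal structures\<close>

text \<open>The diagonal gets weight 0, so that it adds nothing to sums over ordered pairs.
  Exchanging \<open>R\<close> and \<open>B\<close> gives the corresponding weight for blue.\<close>

definition wt :: "('a \<Rightarrow> 'a \<Rightarrow> bool) \<Rightarrow> ('a \<Rightarrow> 'a \<Rightarrow> bool) \<Rightarrow> 'a \<Rightarrow> 'a \<Rightarrow> int" where
  "wt R B x y = (if R x y then 1 else if B x y \<or> x = y then 0 else -1)"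

text \<open>
  Pairs are ordered, so \<open>excess R B T\<close> is twice the number of red edges minus non-edges inside \<open>T\<close>.
\<close>

definition excess :: "('a \<Rightarrow> 'a \<Rightarrow> bool) \<Rightarrow> ('a \<Rightarrow> 'a \<Rightarrow> bool) \<Rightarrow> 'a set \<Rightarrow> int" where
  "excess R B T = (\<Sum>x\<in>T. \<Sum>y\<in>T. wt R B x y)"

definition deg :: "('a \<Rightarrow> 'a \<Rightarrow> bool) \<Rightarrow> 'a \<Rightarrow> int" where
  "deg R x = int (card {y. R x y})"

definition mixed :: "('a \<Rightarrow> 'a \<Rightarrow> bool) \<Rightarrow> ('a \<Rightarrow> 'a \<Rightarrow> bool) \<Rightarrow> 'a \<Rightarrow> bool" where
  "mixed R B x \<longleftrightarrow> (\<exists>y. R x y) \<and> (\<exists>y. B x y)"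

definition alternating_C4 :: "'a set \<Rightarrow> ('a \<Rightarrow> 'a \<Rightarrow> bool) \<Rightarrow> ('a \<Rightarrow> 'a \<Rightarrow> bool) \<Rightarrow> bool" where
  "alternating_C4 V R B \<longleftrightarrow> (\<exists>a b c d. distinct [a, b, c, d] \<and> V = {a, b, c, d} \<and>
     R a b \<and> B b c \<and> R c d \<and> B d a \<and> \<not> R a c \<and> \<not> B a c \<and> \<not> R b d \<and> \<not> B b d)"

lemma mixed_swap: "mixed B R x \<longleftrightarrow> mixed R B x"
  by (auto simp: mixed_def)

text \<open>\<open>X\<close>, \<open>F\<close>, \<open>G\<close> play the roles of the parts of
  sizes m or m + 1, m and m, with m = \<open>card F\<close>. The equivalences range over the whole
  type, so they fix all non-edges as well.\<close>

definition H_structure ::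
    "('a \<Rightarrow> 'a \<Rightarrow> bool) \<Rightarrow> ('a \<Rightarrow> 'a \<Rightarrow> bool) \<Rightarrow> 'a set \<Rightarrow> 'a set \<Rightarrow> 'a set \<Rightarrow> bool" where
  "H_structure R B X F G \<longleftrightarrow> X \<inter> F = {} \<and> X \<inter> G = {} \<and> F \<inter> G = {} \<and>
     card F \<ge> 1 \<and> card F = card G \<and> (card X = card F \<or> card X = card F + 1) \<and>
     (\<forall>x y. R x y \<longleftrightarrow> x \<in> X \<and> y \<in> F \<or> x \<in> F \<and> y \<in> X \<or> x \<in> F \<and> y \<in> F \<and> x \<noteq> y) \<and>
     (\<forall>x y. B x y \<longleftrightarrow> x \<in> X \<and> y \<in> G \<or> x \<in> G \<and> y \<in> X \<or> x \<in> G \<and> y \<in> G \<and> x \<noteq> y)"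

lemma H_structure_swap: "H_structure B R X G F \<Longrightarrow> H_structure R B X F G"
  unfolding H_structure_def by (elim conjE, intro conjI) (simp_all add: Int_commute)

lemma int_card_Un_disjoint:
  assumes "finite A" "finite C" "A \<inter> C = {}"
  shows "int (card (A \<union> C)) = int (card A) + int (card C)"
  using assms by (simp add: card_Un_disjoint)

subsection \<open>Infeasible systems of degree inequalities\<close>

text \<open>
  The variables \<open>rx\<close>, \<open>bx\<close> stand for the red and blue degree of a mixed vertex \<open>x\<close> (\<open>by'\<close> replaces the
  keyword for the blue degree of \<open>y\<close>) and \<open>N\<close> for the number of vertices minus one; \<open>dw\<close>, \<open>du\<close> are the
  degrees of a purely blue and a purely red vertex; \<open>a\<close> bounds all degrees and \<open>c\<close> all blue degrees of
  mixed vertices.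
\<close>

lemma mixed_chain_arith:
  fixes a N rv bv rw bw ru bu :: int
  assumes "1 \<le> bv" "rv = a" "1 \<le> bw" "bw \<le> a" "1 \<le> ru" "ru \<le> a" "bu \<le> a"
    "2 * rw + bw - N \<ge> 0 \<or> 2 * bw + rw - N \<ge> 0"
    "2 * rv + bv - N \<ge> 0 \<or> 2 * bv + rv - N \<ge> 0"
    "rv + bv + rw + bw \<le> N + 1 \<or> 2 * rv + 2 * rw \<le> N"
    "\<not> (bv = 1 \<and> bw = 1 \<and> rv = rw \<and> N = 2 * rv + 1)"
    "bu + ru + bw \<le> N"
    "2 * bw + rw - N + (2 * bu + ru - N) \<ge> 0 \<or> 2 * rw + bw - N + (2 * ru + bu - N) \<ge> 1"
    "\<not> (rw = 1 \<and> ru = 1 \<and> bw = bu \<and> N = 2 * bw + 1)"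
  shows False
  using assms by (smt (z3))

lemma blue_edge_pure_nbr_arith:
  fixes a N bv c dw du rx bx ry by' :: int
  assumes "a + 1 \<le> 2 * bv" "bv \<le> c" "c \<le> a" "dw + a \<le> N" "du + c \<le> N"
    "2 * du + dw + 1 \<ge> 2 * N \<or> du + 2 * dw + 1 \<ge> 2 * N"
    "1 \<le> rx" "rx \<le> a" "1 \<le> bx" "bx \<le> c" "2 * bx + rx + 1 \<ge> 2 * a"
    "1 \<le> ry" "ry \<le> a" "1 \<le> by'" "by' \<le> c" "2 * by' + ry + 1 \<ge> 2 * a"
    "2 * rx + bx - N + (2 * ry + by' - N) \<ge> 0 \<or> 2 * bx + rx - N + (2 * by' + ry - N) \<ge> 1"
    "rx + bx + ry + by' \<le> N + 1 \<or> 2 * rx + 2 * ry \<le> N"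
    "\<not> (bx = 1 \<and> by' = 1 \<and> rx = ry \<and> N = 2 * rx + 1)"
  shows False
  using assms by (smt (z3))

lemma red_edge_pure_nbr_arith:
  fixes a N dw du rx bx ry by' :: int
  assumes "dw + a \<le> N" "2 * du \<ge> N"
    "2 * du + dw + 1 \<ge> 2 * N \<or> du + 2 * dw + 1 \<ge> 2 * N"
    "rx \<le> a" "1 \<le> bx" "2 * bx + rx + 1 \<ge> 2 * a"
    "2 * rx + bx - N \<ge> 0 \<or> 2 * bx + rx - N \<ge> 0" "2 * ry + by' - N \<ge> 0 \<or> 2 * by' + ry - N \<ge> 0"
    "ry + 1 \<le> 2 * by'" "bx + by' + du \<le> N"
  shows False
  using assms by (smt (z3))

lemma mixed_nbr_blue_arith:
  fixes a N bv c rt ru bu ry by' :: int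
  assumes "a + 1 \<le> 2 * bv" "bv \<le> c"
    "1 \<le> rt" "2 * rt + c - N \<ge> 0 \<or> 2 * c + rt - N \<ge> 0"
    "1 \<le> ru" "ru \<le> a" "1 \<le> bu" "2 * ru + bu - N \<ge> 0 \<or> 2 * bu + ru - N \<ge> 0"
    "c + rt + bu + ru \<le> N + 1 \<or> 2 * c + 2 * bu \<le> N"
    "\<not> (rt = 1 \<and> ru = 1 \<and> c = bu \<and> N = 2 * c + 1)"
    "1 \<le> by'" "by' \<le> c" "2 * by' + ry + 1 \<ge> 2 * a"
    "2 * ru + bu - N + (2 * ry + by' - N) \<ge> 0 \<or> 2 * bu + ru - N + (2 * by' + ry - N) \<ge> 1"
    "ru + bu + ry + by' \<le> N + 1 \<or> 2 * ru + 2 * ry \<le> N"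
    "\<not> (bu = 1 \<and> by' = 1 \<and> ru = ry \<and> N = 2 * ru + 1)"
  shows False
  using assms by (smt (z3))

lemma mixed_nbr_common_arith:
  fixes c N rt ru bu :: int
  assumes "1 \<le> rt" "2 * rt + c - N \<ge> 0 \<or> 2 * c + rt - N \<ge> 0"
    "1 \<le> ru" "bu \<le> c" "2 * ru + bu - N \<ge> 0 \<or> 2 * bu + ru - N \<ge> 0"
    "\<not> (rt = 1 \<and> ru = 1 \<and> c = bu \<and> N = 2 * c + 1)"
    "ru + 1 \<le> 2 * bu"
  shows "N + 2 \<le> c + rt + bu + ru"
  using assms by (smt (z3))

text \<open>The bounds on \<open>c\<close> and \<open>by'\<close> give
  \<open>c + by' \<ge> a + 1\<close>, hence \<open>bu + ru + a + 1 \<le> N\<close>, while either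
  alternative of the disjunction yields \<open>N \<le> bu + ru + a\<close>.\<close>

lemma mixed_triangle_arith:
  fixes a N bv c ru bu ry by' :: int
  assumes "a + 1 \<le> 2 * bv" "bv \<le> c" "c \<le> a" "ru \<le> a" "bu \<le> c"
    "2 * ru + bu - N \<ge> 0 \<or> 2 * bu + ru - N \<ge> 0"
    "2 * by' + ry + 1 \<ge> 2 * a" "ry + 1 \<le> 2 * by'" "bu + ru + c + by' \<le> N"
  shows False
  using assms by (smt (z3))

subsection \<open>Degrees without non-monochromatic triangles\<close>

text \<open>Colours are symmetric relations here. A non-monochromatic triangle contains a red and a
  blue edge sharing a vertex, so its absence is exactly \<open>cherry\<close>.\<close>

locale no_nmt =
  fixes V :: "'a set" and R B :: "'a \<Rightarrow> 'a \<Rightarrow> bool"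
  assumes fin: "finite V"
    and R_in: "R x y \<Longrightarrow> x \<in> V" and B_in: "B x y \<Longrightarrow> x \<in> V"
    and R_sym: "R x y \<Longrightarrow> R y x" and B_sym: "B x y \<Longrightarrow> B y x"
    and R_irrefl: "\<not> R x x" and B_irrefl: "\<not> B x x"
    and RB_disj: "R x y \<Longrightarrow> \<not> B x y"
    and cherry: "R x y \<Longrightarrow> B y z \<Longrightarrow> \<not> R x z \<and> \<not> B x z"
begin

abbreviation N :: int where "N \<equiv> int (card V) - 1"

text \<open>The axioms are symmetric in the colours; facts below are proved for one colour and
  reused for the other through this.\<close>

lemma swap_no_nmt: "no_nmt V B R"
proof
  show "\<not> B x z \<and> \<not> R x z" if "B x y" "R y z" for x y z
    using that cherry[of z y x] R_sym B_sym by blast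
qed (fact fin, fact B_in, fact R_in, fact B_sym, fact R_sym, fact B_irrefl, fact R_irrefl,
  use RB_disj in blast)

lemma R_in2: "R x y \<Longrightarrow> y \<in> V" and B_in2: "B x y \<Longrightarrow> y \<in> V"
  using R_sym R_in B_sym B_in by blast+

lemma finR: "finite {y. R x y}" and finB: "finite {y. B x y}"
  by (rule finite_subset[OF _ fin], use R_in2 B_in2 in blast)+

lemma wt_sym: "wt R B x y = wt R B y x"
proof -
  have "R x y \<longleftrightarrow> R y x" "B x y \<longleftrightarrow> B y x" using R_sym B_sym by blast+
  then show ?thesis by (auto simp: wt_def)
qed

lemma deg_nonneg: "0 \<le> deg R x" by (simp add: deg_def)

lemma deg_ge1: "R x y \<Longrightarrow> 1 \<le> deg R x"
proof -
  assume "R x y"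
  then have "card {y. R x y} \<noteq> 0" using finR[of x] by auto
  then show ?thesis by (simp add: deg_def)
qed

lemma deg_zero: "(\<And>y. \<not> R x y) \<Longrightarrow> deg R x = 0" by (simp add: deg_def)

text \<open>Since \<open>x\<close> has \<open>N - deg R x - deg B x\<close> non-neighbours, the
  right-hand side is the number of red edges at \<open>x\<close> minus the number of non-edges at
  \<open>x\<close>.\<close>

lemma row_sum:
  assumes "x \<in> V"
  shows "(\<Sum>y\<in>V. wt R B x y) = 2 * deg R x + deg B x - N"
proof -
  have e: "wt R B x y = 2 * (if R x y then 1 else 0) + (if B x y then 1 else 0)
      + (if y = x then 1 else 0) - 1" for y
    using R_irrefl B_irrefl RB_disj by (auto simp: wt_def)
  have R: "(\<Sum>y\<in>V. if R x y then 1 else 0 :: int) = deg R x"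
  proof -
    have "(\<Sum>y\<in>V. if R x y then 1 else 0 :: int) = int (card (V \<inter> {y. R x y}))"
      using fin by (simp add: sum.If_cases)
    also have "V \<inter> {y. R x y} = {y. R x y}" using R_in2 by auto
    finally show ?thesis by (simp add: deg_def)
  qed
  have B: "(\<Sum>y\<in>V. if B x y then 1 else 0 :: int) = deg B x"
  proof -
    have "(\<Sum>y\<in>V. if B x y then 1 else 0 :: int) = int (card (V \<inter> {y. B x y}))"
      using fin by (simp add: sum.If_cases)
    also have "V \<inter> {y. B x y} = {y. B x y}" using B_in2 by auto
    finally show ?thesis by (simp add: deg_def)
  qed
  show ?thesis
    using R B assms fin
    by (simp add: e sum.distrib sum_subtractf flip: sum_distrib_left)
qed

lemma excess_rows: "excess R B V = (\<Sum>x\<in>V. 2 * deg R x + deg B x - N)"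
  unfolding excess_def by (rule sum.cong) (auto simp: row_sum)

text \<open>Ordered pairs between \<open>S\<close> and its complement occur twice in the excess of
  \<open>V\<close>. Subtracting the rows of \<open>S\<close> twice removes them, but removes the
  pairs inside \<open>S\<close> once too often.\<close>

lemma excess_diff:
  assumes "S \<subseteq> V"
  shows "excess R B (V - S) = excess R B V - 2 * (\<Sum>x\<in>S. 2 * deg R x + deg B x - N) + excess R B S"
proof -
  let ?w = "wt R B"
  have split: "sum f V = sum f (V - S) + sum f S" for f :: "'a \<Rightarrow> int"
    using fin assms by (metis add.commute sum.subset_diff)
  have cross: "(\<Sum>x\<in>V - S. \<Sum>y\<in>S. ?w x y) = (\<Sum>x\<in>S. \<Sum>y\<in>V - S. ?w x y)"
    by (subst sum.swap) (intro sum.cong refl wt_sym)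
  have "excess R B V = excess R B (V - S) + (\<Sum>x\<in>V - S. \<Sum>y\<in>S. ?w x y) + (\<Sum>x\<in>S. \<Sum>y\<in>V. ?w x y)"
    unfolding excess_def by (subst split) (simp add: split sum.distrib)
  moreover have "(\<Sum>x\<in>S. \<Sum>y\<in>V. ?w x y) = (\<Sum>x\<in>S. \<Sum>y\<in>V - S. ?w x y) + excess R B S"
    unfolding excess_def by (simp add: split sum.distrib)
  moreover have "(\<Sum>x\<in>S. \<Sum>y\<in>V. ?w x y) = (\<Sum>x\<in>S. 2 * deg R x + deg B x - N)"
    by (rule sum.cong) (use assms in \<open>auto simp: row_sum\<close>)
  ultimately show ?thesis using cross by linarith
qed

lemma card_le_N: "S \<subseteq> V \<Longrightarrow> int (card S) \<le> N + 1"
  using card_mono[OF fin, of S] by linarith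

lemma cherry_nonadj: assumes "R v u" "B v w" shows "\<not> R u w" "\<not> B u w" "\<not> R w u" "\<not> B w u" "u \<noteq> w"
  using assms cherry R_sym B_sym RB_disj by metis+

lemma nbr_sum: "deg R x + deg B x = int (card ({y. R x y} \<union> {y. B x y}))"
  unfolding deg_def by (subst int_card_Un_disjoint) (use finR finB RB_disj in auto)

text \<open>A red neighbour of \<open>v\<close> cannot be adjacent to \<open>w\<close>, so the
  closed neighbourhood of \<open>w\<close> and the red neighbourhood of \<open>v\<close> are
  disjoint.\<close>

lemma blue_nbr: assumes "B v w" shows "deg R w + deg B w + deg R v \<le> N"
proof -
  let ?A = "{y. R w y} \<union> {y. B w y}"
  have d: "insert w ?A \<inter> {y. R v y} = {}" using cherry_nonadj[OF _ assms] assms RB_disj by auto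
  have "int (card (insert w ?A \<union> {y. R v y})) = int (card ?A) + 1 + deg R v"
    unfolding deg_def using d finR finB R_irrefl B_irrefl by (subst int_card_Un_disjoint) auto
  moreover have "insert w ?A \<union> {y. R v y} \<subseteq> V" using assms R_in2 B_in2 by auto
  ultimately show ?thesis using card_le_N[of "insert w ?A \<union> {y. R v y}"] nbr_sum[of w] by linarith
qed

lemma blue_closes_triangle:
  assumes "B x y" "B x t" "R y t \<or> B y t" shows "B y t"
  using assms cherry R_sym B_sym by metis

text \<open>The two neighbourhoods are too large to be disjoint, and a common neighbour of the ends
  of a blue edge must be joined to both in blue.\<close>

lemma blue_common:
  assumes "B x y" "deg R x + deg B x + deg R y + deg B y \<ge> N + 2"
  obtains t where "B x t" "B y t"
proof -
  let ?n = "\<lambda>x. {y. R x y} \<union> {y. B x y}"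
  have "\<not> ?n x \<inter> ?n y = {}"
  proof
    assume "?n x \<inter> ?n y = {}"
    then have "int (card (?n x \<union> ?n y)) = deg R x + deg B x + (deg R y + deg B y)"
      unfolding nbr_sum by (intro int_card_Un_disjoint) (use finR finB in auto)
    moreover have "?n x \<union> ?n y \<subseteq> V" using R_in2 B_in2 by auto
    ultimately show False using card_le_N[of "?n x \<union> ?n y"] assms by linarith
  qed
  then obtain t where t: "R x t \<or> B x t" "R y t \<or> B y t" by auto
  have "B x t" using t assms cherry_nonadj[of x t y] by metis
  then show ?thesis using that blue_closes_triangle[OF assms(1) _ t(2)] by blast
qed

text \<open>The closed neighbourhood of \<open>t\<close> and the red neighbourhoods of
  \<open>x\<close> and \<open>y\<close> are pairwise disjoint, because all three sides are
  blue.\<close>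

lemma blue_triangle_nbr:
  assumes "B x y" "B x t" "B y t"
  shows "deg R t + deg B t + deg R x + deg R y \<le> N"
proof -
  let ?A = "{y. R t y} \<union> {y. B t y}"
  have 1: "{z. R x z} \<inter> {z. R y z} = {}" using assms cherry_nonadj by blast
  have d: "insert t ?A \<inter> ({z. R x z} \<union> {z. R y z}) = {}"
    using cherry_nonadj[OF _ assms(2)] cherry_nonadj[OF _ assms(3)] assms RB_disj by auto
  have "int (card (insert t ?A \<union> ({z. R x z} \<union> {z. R y z}))) = int (card ?A) + 1 + int (card ({z. R x z} \<union> {z. R y z}))"
    using d finR finB R_irrefl B_irrefl by (subst int_card_Un_disjoint) auto
  also have "int (card ({z. R x z} \<union> {z. R y z})) = deg R x + deg R y"
    unfolding deg_def using 1 finR by (subst int_card_Un_disjoint) auto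
  finally have "int (card (insert t ?A \<union> ({z. R x z} \<union> {z. R y z}))) = int (card ?A) + 1 + (deg R x + deg R y)" .
  moreover have "insert t ?A \<union> ({z. R x z} \<union> {z. R y z}) \<subseteq> V" using assms R_in2 B_in2 by auto
  ultimately show ?thesis using card_le_N[of "insert t ?A \<union> ({z. R x z} \<union> {z. R y z})"] nbr_sum[of t] by linarith
qed

text \<open>Some other vertex is not adjacent to \<open>x\<close>: either \<open>y\<close> itself,
  or a neighbour of \<open>y\<close> along the colour that the edge \<open>xy\<close> does not
  have.\<close>

lemma mixed_pair_nonuniversal:
  assumes "mixed R B x" "mixed R B y" "x \<noteq> y"
  shows "deg R x + deg B x + 1 \<le> N"
proof -
  obtain t where t: "t \<in> V" "t \<noteq> x" "\<not> R x t" "\<not> B x t"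
  proof (cases "R x y \<or> B x y")
    case False
    then show ?thesis using that[of y] assms R_in by (auto simp: mixed_def)
  next
    case True
    obtain s s' where s: "R y s" "B y s'" using assms by (auto simp: mixed_def)
    from True show ?thesis
    proof
      assume "R x y"
      then show ?thesis using that[of s'] s cherry_nonadj[of y x s'] R_sym B_in2 by metis
    next
      assume "B x y"
      then show ?thesis using that[of s] s cherry_nonadj[of y s x] B_sym R_in2 by metis
    qed
  qed
  let ?A = "{y. R x y} \<union> {y. B x y}"
  have "x \<in> V" using assms R_in by (auto simp: mixed_def)
  then have "insert x (insert t ?A) \<subseteq> V" using t R_in2 B_in2 by auto
  moreover have "int (card (insert x (insert t ?A))) = int (card ?A) + 2"
    using t finR finB R_irrefl B_irrefl by auto
  ultimately show ?thesis using card_le_N[of "insert x (insert t ?A)"] nbr_sum[of x] by linarith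
qed

end

subsection \<open>Minimal configurations\<close>

text \<open>Weak inequalities for \<open>V\<close> let the same locale serve a minimal
  counterexample to the bound and the equality case.\<close>

locale critical = no_nmt +
  assumes exR: "0 \<le> excess R B V" and exB: "0 \<le> excess B R V"
    and sub: "T \<subset> V \<Longrightarrow> excess R B T \<le> 0 \<or> excess B R T \<le> 0"
    and R_ne: "\<exists>x y. R x y" and B_ne: "\<exists>x y. B x y"
begin

lemma swap: "critical V B R"
proof -
  interpret S: no_nmt V B R by (rule swap_no_nmt)
  show ?thesis by unfold_locales (use exR exB sub R_ne B_ne in blast)+
qed

section \<open>Gains and deletion inequalities\<close>

abbreviation gainR where "gainR x \<equiv> 2 * deg R x + deg B x - N"
abbreviation gainB where "gainB x \<equiv> 2 * deg B x + deg R x - N"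

text \<open>The proper subset \<open>V - S\<close> has a nonpositive excess in some colour, whereas
  \<open>V\<close> has a nonnegative one; \<open>excess_diff\<close> compares them.\<close>

lemma removal:
  assumes "S \<subseteq> V" "S \<noteq> {}"
  shows "excess R B S \<le> 2 * sum gainR S \<or> excess B R S \<le> 2 * sum gainB S"
proof -
  interpret S: no_nmt V B R by (rule swap_no_nmt)
  have "V - S \<subset> V" using assms by auto
  from sub[OF this] show ?thesis
    using excess_diff[OF assms(1)] S.excess_diff[OF assms(1)] exR exB by linarith
qed

lemma removal1: assumes "x \<in> V" shows "gainR x \<ge> 0 \<or> gainB x \<ge> 0"
  using removal[of "{x}"] assms R_irrefl B_irrefl by (auto simp: excess_def wt_def)

lemma removal2:
  assumes "x \<in> V" "y \<in> V" "x \<noteq> y"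
  shows "gainR x + gainR y \<ge> wt R B x y \<or> gainB x + gainB y \<ge> wt B R x y"
proof -
  interpret S: no_nmt V B R by (rule swap_no_nmt)
  have "excess R B {x, y} = 2 * wt R B x y" "excess B R {x, y} = 2 * wt B R x y"
    using assms R_irrefl B_irrefl wt_sym[of y x] S.wt_sym[of y x]
    by (simp_all add: excess_def) (simp_all add: wt_def)
  then show ?thesis using removal[of "{x, y}"] assms by auto
qed

lemma removal4:
  assumes "x \<in> V" "y \<in> V" "w \<in> V" "t \<in> V" "distinct [x, y, w, t]"
  shows "gainR x + gainR y + gainR w + gainR t \<ge> wt R B x y + wt R B y w + wt R B x w + wt R B x t + wt R B y t + wt R B w t
    \<or> gainB x + gainB y + gainB w + gainB t \<ge> wt B R x y + wt B R y w + wt B R x w + wt B R x t + wt B R y t + wt B R w t"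
proof -
  interpret S: no_nmt V B R by (rule swap_no_nmt)
  have z: "wt R B x x = 0" "wt B R x x = 0" for x using R_irrefl B_irrefl by (auto simp: wt_def)
  have "excess R B {x, y, w, t} = 2 * (wt R B x y + wt R B y w + wt R B x w + wt R B x t + wt R B y t + wt R B w t)"
       "excess B R {x, y, w, t} = 2 * (wt B R x y + wt B R y w + wt B R x w + wt B R x t + wt B R y t + wt B R w t)"
    using assms wt_sym[of y x] wt_sym[of w x] wt_sym[of w y] wt_sym[of t x] wt_sym[of t y] wt_sym[of t w]
      S.wt_sym[of y x] S.wt_sym[of w x] S.wt_sym[of w y] S.wt_sym[of t x] S.wt_sym[of t y] S.wt_sym[of t w]
    by (simp_all add: excess_def z)
  then show ?thesis using removal[of "{x, y, w, t}"] assms by (auto simp: algebra_simps)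
qed

lemma alternating_C4_swap: "alternating_C4 V B R \<Longrightarrow> alternating_C4 V R B"
proof -
  assume "alternating_C4 V B R"
  then obtain a b c d where *: "distinct [a, b, c, d]" "V = {a, b, c, d}" "B a b" "R b c" "B c d" "R d a"
     "\<not> B a c" "\<not> R a c" "\<not> B b d" "\<not> R b d" unfolding alternating_C4_def by blast
  have "distinct [b, c, d, a] \<and> V = {b, c, d, a} \<and> R b c \<and> B c d \<and> R d a \<and> B a b
     \<and> \<not> R b d \<and> \<not> B b d \<and> \<not> R c a \<and> \<not> B c a"
    using * R_sym B_sym by auto
  then show "alternating_C4 V R B" unfolding alternating_C4_def by blast
qed

lemma pure_blue: "B v w \<Longrightarrow> \<not> mixed R B w \<Longrightarrow> deg R w = 0"
  using B_sym deg_zero by (auto simp: mixed_def)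

lemma mixed_in: "mixed R B x \<Longrightarrow> x \<in> V" using R_in by (auto simp: mixed_def)

lemma mixed_facts:
  assumes "mixed R B x"
  shows "deg R x \<ge> 1" "deg B x \<ge> 1" "gainR x \<ge> 0 \<or> gainB x \<ge> 0"
proof -
  interpret S: critical V B R by (rule swap)
  show "deg R x \<ge> 1" "deg B x \<ge> 1" using assms deg_ge1 S.deg_ge1 by (auto simp: mixed_def)
  show "gainR x \<ge> 0 \<or> gainB x \<ge> 0" using removal1 assms mixed_in by blast
qed

text \<open>If both alternatives fail, \<open>x\<close> and \<open>y\<close> have a common blue
  neighbour \<open>t\<close>. The triangle bound then leaves \<open>t\<close> fewer than
  \<open>N / 2\<close> neighbours, so both gains of \<open>t\<close> are negative.\<close>

lemma blue_edge_common:
  assumes "B x y"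
  shows "deg R x + deg B x + deg R y + deg B y \<le> N + 1 \<or> 2 * deg R x + 2 * deg R y \<le> N"
proof (rule ccontr)
  assume *: "\<not> ?thesis"
  then have "deg R x + deg B x + deg R y + deg B y \<ge> N + 2" by linarith
  then obtain t where t: "B x t" "B y t" using assms blue_common by blast
  have "gainR t \<ge> 0 \<or> gainB t \<ge> 0" using removal1 t B_in2 by blast
  then show False using blue_triangle_nbr[OF assms t] * deg_nonneg[of t]
    no_nmt.deg_nonneg[OF swap_no_nmt, of t] by linarith
qed

lemma blue_edge_removal:
  assumes "B x y"
  shows "gainR x + gainR y \<ge> 0 \<or> gainB x + gainB y \<ge> 1"
proof -
  have "wt R B x y = 0" "wt B R x y = 1" using assms RB_disj by (auto simp: wt_def)
  then show ?thesis
    using removal2[of x y] assms B_in B_in2 B_irrefl by metis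
qed

text \<open>When \<open>x\<close> and \<open>w\<close> are deleted, the red alternative would make
  \<open>x\<close> adjacent to all other vertices. The blue one, with the bound on
  \<open>deg B w\<close>, gives the last inequality.\<close>

lemma pure_blue_nbr:
  assumes "mixed R B x" "B x w" "\<not> mixed R B w" "deg R x + deg B x + 1 \<le> N"
  shows "deg R w = 0" "deg B w + deg R x \<le> N" "deg R x + 1 \<le> 2 * deg B x"
proof -
  show w: "deg R w = 0" using pure_blue assms by blast
  show w2: "deg B w + deg R x \<le> N" using blue_nbr[OF assms(2)] w by linarith
  show "deg R x + 1 \<le> 2 * deg B x"
    using blue_edge_removal[OF assms(2)] w w2 assms(4) by linarith
qed

section \<open>Isolated blue edges and the alternating 4-cycle\<close>

text \<open>This is the boundary case of the degree inequalities. Blue edges at \<open>u\<close> can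
  only lead to red neighbours of \<open>y\<close>, since \<open>u\<close> is not adjacent to
  \<open>y\<close> and its blue neighbours are not red neighbours of \<open>x\<close>.\<close>

lemma isolated_blue_edge_nbr:
  assumes B: "B x y" and dB: "deg B x = 1" "deg B y = 1"
    and dR: "deg R x = k" "deg R y = k" and N: "N = 2 * k + 1"
    and V: "V = {x, y} \<union> {z. R x z} \<union> {z. R y z}" and u: "R x u"
  shows "{t. B u t} \<subseteq> {z. R y z}" "deg B u \<le> 1" "deg R u + deg B u + 1 \<le> N"
proof -
  interpret S: critical V B R by (rule swap)
  have sub: "{t. B u t} \<subseteq> {z. R y z}" if "R x u" "B x y"
      "V = {x, y} \<union> {z. R x z} \<union> {z. R y z}" for u x y
  proof
    fix t assume "t \<in> {t. B u t}"
    then have t: "B u t" by simp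
    have "\<not> R x t" using cherry[OF that(1) t] by simp
    moreover have "t \<noteq> x" using t that R_sym B_sym RB_disj by metis
    moreover have "t \<noteq> y" using t that cherry_nonadj[of x u y] by metis
    ultimately show "t \<in> {z. R y z}" using B_in2[OF t] that(3) by auto
  qed
  show "{t. B u t} \<subseteq> {z. R y z}" by (rule sub[OF u B V])
  have V': "V = {y, x} \<union> {z. R y z} \<union> {z. R x z}" using V by auto
  show "deg R u + deg B u + 1 \<le> N" using S.blue_nbr[OF u] dB by linarith
  show "deg B u \<le> 1"
  proof (cases "\<exists>t. B u t")
    case False then show ?thesis using S.deg_zero[of u] by auto
  next
    case True
    then obtain t where t: "B u t" by blast
    have yt: "R y t" using sub[OF u B V] t by auto
    note ne = cherry_nonadj[OF u B] cherry_nonadj[OF yt B_sym[OF B]]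
    have "wt R B x y = 0" "wt R B y u = -1" "wt R B x u = 1" "wt R B x t = -1" "wt R B y t = 1" "wt R B u t = 0"
      "wt B R x y = 1" "wt B R y u = -1" "wt B R x u = 0" "wt B R x t = -1" "wt B R y t = 0" "wt B R u t = 1"
      using ne t yt u B RB_disj by (auto simp: wt_def)
    moreover have "distinct [x, y, u, t]" using ne t yt u B R_irrefl B_irrefl by auto
    moreover have "x \<in> V" "y \<in> V" "u \<in> V" "t \<in> V" using B u t B_in B_in2 R_in2 by blast+
    \<comment> \<open>In either colour the six weights add up to 0.\<close>
    ultimately have rem: "gainR x + gainR y + gainR u + gainR t \<ge> 0 \<or> gainB x + gainB y + gainB u + gainB t \<ge> 0"
      using removal4[of x y u t] by linarith
    have b: "deg B u \<le> k" "deg B t \<le> k"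
    proof -
      show "deg B u \<le> k" using card_mono[OF finR sub[OF u B V]] dR by (simp add: deg_def)
      show "deg B t \<le> k" using card_mono[OF finR sub[OF yt B_sym[OF B] V']] dR by (simp add: deg_def)
    qed
    have r: "deg R u \<ge> 1" "deg R t \<ge> 1" using deg_ge1 R_sym u yt by blast+
    have e: "deg R t + deg B t + deg R u \<le> N" "deg R u + deg B u + deg R t \<le> N"
      using blue_nbr t B_sym by blast+
    \<comment> \<open>If the bound on the blue edge \<open>ut\<close> is not tight,
      \<open>rem\<close> forces \<open>k = 1\<close>. If it is tight, the closed neighbourhood of
      \<open>t\<close> and the red neighbourhood of \<open>u\<close> cover \<open>V\<close>, so a
      second blue neighbour \<open>s\<close> of \<open>u\<close> is adjacent to \<open>t\<close>. As
      \<open>s\<close> and \<open>t\<close> are red neighbours of \<open>y\<close>, the edge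
      \<open>st\<close> is red, and \<open>s\<close>, \<open>t\<close>, \<open>u\<close> form a
      forbidden triangle.\<close>
    show ?thesis
    proof (cases "deg R t + deg B t + deg R u = N")
      case False
      have "k = 1" using rem False b r e dB dR N by (smt (z3))
      then show ?thesis using b by simp
    next
      case True
      let ?A = "{y. R t y} \<union> {y. B t y}"
      have d: "insert t ?A \<inter> {y. R u y} = {}" using cherry_nonadj[OF _ t] t RB_disj by auto
      have "int (card (insert t ?A \<union> {y. R u y})) = int (card ?A) + 1 + deg R u"
        unfolding deg_def using d finR finB R_irrefl B_irrefl by (subst int_card_Un_disjoint) auto
      then have "card (insert t ?A \<union> {y. R u y}) = card V" using True nbr_sum[of t] by linarith
      moreover have "insert t ?A \<union> {y. R u y} \<subseteq> V" using t R_in2 B_in2 by auto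
      ultimately have all: "insert t ?A \<union> {y. R u y} = V" using card_subset_eq[OF fin] by blast
      have "s = t" if s: "B u s" for s
      proof (rule ccontr)
        assume "s \<noteq> t"
        then have "R t s \<or> B t s" using all s B_in2[OF s] RB_disj[of u s] by auto
        moreover have "R y s" using sub[OF u B V] s by auto
        ultimately have "R t s" using cherry_nonadj[of t y s] yt R_sym by metis
        then show False using cherry_nonadj[of t s u] t s B_sym by metis
      qed
      then have "{s. B u s} = {t}" using t by blast
      then show ?thesis by (simp add: deg_def)
    qed
  qed
qed

text \<open>\<open>x\<close>, \<open>y\<close> and their disjoint red neighbourhoods exhaust
  \<open>V\<close>. The ends have blue gain \<open>1 - k\<close> and all other vertices at most 0,
  so a nonnegative blue excess forces \<open>k = 1\<close> and equality everywhere.\<close>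

lemma isolated_blue_edge_alternating:
  assumes B: "B x y" and dB: "deg B x = 1" "deg B y = 1"
    and dR: "deg R x = k" "deg R y = k" and N: "N = 2 * k + 1" and k: "k \<ge> 1"
  shows "alternating_C4 V R B"
proof -
  interpret S: critical V B R by (rule swap)
  let ?X = "{z. R x z}" and ?Y = "{z. R y z}"
  have d: "?X \<inter> ?Y = {}" using cherry_nonadj[OF _ B] cherry_nonadj R_sym by blast
  have xy: "x \<noteq> y" "x \<notin> ?X \<union> ?Y" "y \<notin> ?X \<union> ?Y" using B B_irrefl R_irrefl RB_disj R_sym B_sym by auto
  have "int (card (?X \<union> ?Y)) = 2 * k" using d finR dR by (subst int_card_Un_disjoint) (auto simp: deg_def)
  then have "int (card ({x, y} \<union> ?X \<union> ?Y)) = 2 * k + 2" using xy finR by simp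
  then have "card ({x, y} \<union> ?X \<union> ?Y) = card V" using N by linarith
  moreover have "{x, y} \<union> ?X \<union> ?Y \<subseteq> V" using B B_in B_in2 R_in2 by auto
  ultimately have V: "V = {x, y} \<union> ?X \<union> ?Y" using card_subset_eq[OF fin] by metis
  then have V': "V = {y, x} \<union> ?Y \<union> ?X" by auto
  note nx = isolated_blue_edge_nbr[OF B dB dR N V]
  note ny = isolated_blue_edge_nbr[OF B_sym[OF B] dB(2,1) dR(2,1) N V']
  have qle: "gainB z \<le> 0" if "z \<in> ?X \<union> ?Y" for z using that nx(2,3)[of z] ny(2,3)[of z] by force
  have qxy: "gainB x = 1 - k" "gainB y = 1 - k" using dB dR N by auto
  have S: "excess B R V = gainB x + gainB y + sum gainB (?X \<union> ?Y)"
  proof -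
    have "excess B R V = sum gainB ({x, y} \<union> (?X \<union> ?Y))" using S.excess_rows V by (simp add: Un_assoc)
    also have "\<dots> = gainB x + gainB y + sum gainB (?X \<union> ?Y)"
      by (subst sum.union_disjoint) (use xy finR in auto)
    finally show ?thesis .
  qed
  have s0: "sum gainB (?X \<union> ?Y) \<le> 0" by (rule sum_nonpos) (use qle in blast)
  have k1: "k = 1" and q0: "sum gainB (?X \<union> ?Y) = 0" using S s0 qxy k exB by linarith+
  obtain u where u: "?X = {u}" using dR(1) k1 card_1_singletonE[of ?X] by (auto simp: deg_def)
  obtain t where t: "?Y = {t}" using dR(2) k1 card_1_singletonE[of ?Y] by (auto simp: deg_def)
  have R: "R x u" "R y t" "u \<noteq> t" using u t d by auto
  have "gainB u + gainB t = 0" using q0 R(3) unfolding u t by simp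
  moreover have "gainB u \<le> 0" "gainB t \<le> 0" using qle[of u] qle[of t] R by blast+
  ultimately have "gainB u = 0" by linarith
  then have "deg B u \<noteq> 0" using nx(3)[OF R(1)] by linarith
  then obtain s where "B u s" using S.deg_zero by blast
  then have "B u t" using nx(1)[OF R(1)] t by auto
  note ne = cherry_nonadj[OF R(1) B] cherry_nonadj[OF R(2) B_sym[OF B]]
  have "distinct [u, x, y, t] \<and> V = {u, x, y, t} \<and> R u x \<and> B x y \<and> R y t \<and> B t u
     \<and> \<not> R u y \<and> \<not> B u y \<and> \<not> R x t \<and> \<not> B x t"
    using V u t R xy B ne \<open>B u t\<close> R_sym B_sym by auto
  then show "alternating_C4 V R B" unfolding alternating_C4_def by blast
qed

lemma no_isolated_blue_edge:
  assumes "\<not> alternating_C4 V R B" "mixed R B x" "mixed R B y" "B x y"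
  shows "\<not> (deg B x = 1 \<and> deg B y = 1 \<and> deg R x = deg R y \<and> N = 2 * deg R x + 1)"
  using isolated_blue_edge_alternating[OF assms(4), of "deg R x"] mixed_facts(1)[OF assms(2)] assms(1) by metis

section \<open>Extremal mixed vertices and edges between mixed vertices\<close>

text \<open>Combines deletion of \<open>v\<close> and of \<open>w\<close>, the common-neighbour
  bound on the blue edge \<open>vw\<close>, the neighbourhood and deletion bounds on the red edge
  \<open>wu\<close>, and the exclusion of isolated edges for both.\<close>

lemma no_mixed_chain:
  assumes "\<not> alternating_C4 V R B" "\<And>x. mixed R B x \<Longrightarrow> deg R x \<le> a \<and> deg B x \<le> a"
    and "deg R v = a" "B v w" "R w u" "mixed R B v" "mixed R B w" "mixed R B u"
  shows False
proof -
  interpret S: critical V B R by (rule swap)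
  have C4: "\<not> alternating_C4 V B R" using assms(1) alternating_C4_swap by metis
  note v = mixed_facts[OF assms(6)] and w = mixed_facts[OF assms(7)] and u = mixed_facts[OF assms(8)]
  have "mixed B R w" "mixed B R u" using assms(7,8) mixed_swap by metis+
  note wu = S.no_isolated_blue_edge[OF C4 this assms(5)]
  show False
    by (rule mixed_chain_arith[OF v(2) assms(3) w(2) conjunct2[OF assms(2)[OF assms(7)]] u(1)
      conjunct1[OF assms(2)[OF assms(8)]] conjunct2[OF assms(2)[OF assms(8)]] w(3) v(3)
      blue_edge_common[OF assms(4)] no_isolated_blue_edge[OF assms(1,6,7,4)]
      S.blue_nbr[OF assms(5)] S.blue_edge_removal[OF assms(5)] wu])
qed

text \<open>Take \<open>v\<close> attaining the maximum \<open>a\<close>, say in red. If a blue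
  neighbour \<open>w\<close> is mixed, deletion of \<open>w\<close> forces one of its degrees to be
  \<open>a\<close>: a blue one either gives a pure red neighbour of \<open>w\<close> or a chain of
  three mixed vertices, and a red one is impossible.\<close>

lemma extremal_mixed:
  assumes nC4: "\<not> alternating_C4 V R B" and x0: "mixed R B x0"
  obtains a v w where "\<And>x. mixed R B x \<Longrightarrow> deg R x \<le> a \<and> deg B x \<le> a"
    "mixed R B v" "\<not> mixed R B w" "deg R v = a \<and> B v w \<or> deg B v = a \<and> R v w"
proof -
  interpret S: critical V B R by (rule swap)
  let ?M = "\<lambda>x. max (deg R x) (deg B x)"
  define a where "a = Max (?M ` {x. mixed R B x})"
  have fX: "finite {x. mixed R B x}" by (rule finite_subset[OF _ fin]) (auto simp: mixed_in)
  have le: "deg R x \<le> a \<and> deg B x \<le> a" if "mixed R B x" for x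
    using Max_ge[of "?M ` {x. mixed R B x}" "?M x"] fX that by (auto simp: a_def)
  have "a \<in> ?M ` {x. mixed R B x}" unfolding a_def using fX x0 by (intro Max_in) auto
  then obtain v where v: "mixed R B v" "?M v = a" by auto
  have C4: "\<not> alternating_C4 V B R" using nC4 alternating_C4_swap by metis
  have main: "\<exists>v w. mixed R' B' v \<and> \<not> mixed R' B' w \<and> (deg R' v = a \<and> B' v w \<or> deg B' v = a \<and> R' v w)"
    if T: "critical V R' B'" and C4: "\<not> alternating_C4 V R' B'"
      and le: "\<And>x. mixed R' B' x \<Longrightarrow> deg R' x \<le> a \<and> deg B' x \<le> a"
      and v: "mixed R' B' v" "deg R' v = a" for R' B' :: "'a \<Rightarrow> 'a \<Rightarrow> bool"
  proof (rule ccontr)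
    assume neg: "\<not> ?thesis"
    interpret T: critical V R' B' by (rule T)
    obtain w where w: "B' v w" using v(1) by (auto simp: mixed_def)
    with neg v have mw: "mixed R' B' w" by blast
    have "deg R' w + deg B' w + a \<le> N" using T.blue_nbr[OF w] v(2) by simp
    then have "deg R' w = a \<or> deg B' w = a" using T.mixed_facts(3)[OF mw] le[OF mw] by linarith
    then show False
    proof
      assume "deg B' w = a"
      moreover obtain u where u: "R' w u" using mw by (auto simp: mixed_def)
      ultimately have "mixed R' B' u" using neg mw by blast
      then show False using T.no_mixed_chain[OF C4 le v(2) w u v(1) mw] by blast
    next
      \<comment> \<open>The bounds become tight: \<open>N\<close> is \<open>2 * a\<close> plus
        either blue degree. The common-neighbour alternative then makes both blue degrees 1, which
        is the excluded isolated edge.\<close>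
      assume a: "deg R' w = a"
      show False
        using T.blue_edge_common[OF w] T.no_isolated_blue_edge[OF C4 v(1) mw w] T.blue_nbr[OF w] T.blue_nbr[OF T.B_sym[OF w]]
          T.mixed_facts[OF v(1)] T.mixed_facts[OF mw] le[OF v(1)] le[OF mw] a v(2) by (smt (z3))
    qed
  qed
  have "deg R v = a \<or> deg B v = a" using v(2) by linarith
  then show thesis
  proof
    assume "deg R v = a"
    then show thesis using main[OF critical_axioms nC4 le v(1)] that[OF le] by blast
  next
    assume "deg B v = a"
    then show thesis using main[OF swap C4] le v(1) that[OF le] unfolding mixed_swap[of B R] by blast
  qed
qed

text \<open>
  Let \<open>t\<close> be a mixed vertex of maximal blue degree. Either \<open>t\<close> has a purely red neighbour \<open>u\<close>, and deleting
  \<open>u\<close> and \<open>w\<close> bounds the degrees of all mixed vertices; or all red neighbours of \<open>t\<close> are mixed, and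
  then \<open>t\<close> lies in a red triangle of mixed vertices, whose disjoint blue neighbourhoods do not fit into \<open>V\<close>.
\<close>

lemma no_mixed_edge_oriented:
  assumes nC4: "\<not> alternating_C4 V R B"
    and le: "\<And>x. mixed R B x \<Longrightarrow> deg R x \<le> a \<and> deg B x \<le> a"
    and v: "mixed R B v" "deg R v = a" and w: "B v w" "\<not> mixed R B w"
    and x: "mixed R B x" and y: "mixed R B y" and xy: "R x y \<or> B x y"
  shows False
proof -
  interpret S: critical V B R by (rule swap)
  have nC4': "\<not> alternating_C4 V B R" using nC4 alternating_C4_swap by metis
  note sw = mixed_swap[of B R, THEN iffD2]
  have nu: "deg R s + deg B s + 1 \<le> N" if "mixed R B s" for s
    using mixed_pair_nonuniversal[OF that] x y xy R_irrefl B_irrefl by metis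
  note rge = mixed_facts(1) and bge = mixed_facts(2) and single = mixed_facts(3)
  note wv = pure_blue_nbr[OF v(1) w nu[OF v(1)], unfolded v(2)]
  have wN: "2 * deg B w \<ge> N"
    using removal1[of w] wv(1,2) B_in2[OF w(1)] v(2) rge[OF v(1)] by linarith
  \<comment> \<open>Delete \<open>s\<close> and \<open>w\<close>. The blue alternative gives the
    bound through \<open>deg B w \<le> N - a\<close>; the red one forces \<open>deg R s = a\<close>
    and \<open>deg R s + deg B s = N - 1\<close>, and then \<open>wN\<close> suffices.\<close>
  have star: "2 * deg B s + deg R s + 1 \<ge> 2 * a" if s: "mixed R B s" for s
  proof -
    have "wt R B s w \<ge> -1" "wt B R s w \<ge> -1" by (auto simp: wt_def)
    then have "gainR s + gainR w \<ge> -1 \<or> gainB s + gainB w \<ge> -1"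
      using removal2[of s w] s w(2) mixed_in[OF s] B_in2[OF w(1)] by (metis order_trans)
    then show ?thesis using wv(1,2) wN nu[OF s] le[OF s] rge[OF s] by linarith
  qed
  have fX: "finite {x. mixed R B x}" by (rule finite_subset[OF _ fin]) (auto simp: mixed_in)
  define c where "c = Max (deg B ` {x. mixed R B x})"
  have lec: "deg B s \<le> c" if "mixed R B s" for s unfolding c_def using fX that by simp
  have "c \<in> deg B ` {x. mixed R B x}" unfolding c_def using fX x by (intro Max_in) auto
  then obtain t where t: "mixed R B t" "deg B t = c" by auto
  have ca: "c \<le> a" using le[OF t(1)] t(2) by simp
  note vc = lec[OF v(1)]
  show False
  proof (cases "\<exists>u. R t u \<and> \<not> mixed R B u")
    case True
    then obtain u where u: "R t u" "\<not> mixed R B u" by blast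
    have u0: "deg B u = 0" using S.pure_blue u mixed_swap[of B R] by metis
    have uc: "deg R u + c \<le> N" using S.blue_nbr[OF u(1)] u0 t(2) by linarith
    have uN: "2 * deg R u \<ge> N"
      using removal1[of u] u0 uc R_in2[OF u(1)] t(2) bge[OF t(1)] by linarith
    have "u \<noteq> w" using u(1) wv(1) deg_ge1[of w t] R_sym by force
    moreover have "wt R B u w \<ge> -1" "wt B R u w \<ge> -1" by (auto simp: wt_def)
    ultimately have "gainR u + gainR w \<ge> -1 \<or> gainB u + gainB w \<ge> -1"
      using removal2[of u w] R_in2[OF u(1)] B_in2[OF w(1)] by (metis order_trans)
    then have uw: "2 * deg R u + deg B w + 1 \<ge> 2 * N \<or> deg R u + 2 * deg B w + 1 \<ge> 2 * N"
      using u0 wv(1) by auto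
    \<comment> \<open>With blue edges excluded, the given edge \<open>xy\<close> is red and all blue
      neighbours of mixed vertices are purely blue.\<close>
    have noblue: False if "mixed R B x" "mixed R B y" "B x y" for x y
      by (rule blue_edge_pure_nbr_arith[OF wv(3) vc ca wv(2) uc uw
        rge[OF that(1)] conjunct1[OF le[OF that(1)]] bge[OF that(1)] lec[OF that(1)] star[OF that(1)]
        rge[OF that(2)] conjunct1[OF le[OF that(2)]] bge[OF that(2)] lec[OF that(2)] star[OF that(2)]
        blue_edge_removal[OF that(3)] blue_edge_common[OF that(3)] no_isolated_blue_edge[OF nC4 that]])
    then have Rxy: "R x y" using x y xy by blast
    have pureB: "\<not> mixed R B s'" if "mixed R B s" "B s s'" for s s' using noblue that by blast
    obtain y' where y': "B y y'" using y by (auto simp: mixed_def)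
    note yy = pure_blue_nbr(3)[OF y y' pureB[OF y y'] nu[OF y]]
    \<comment> \<open>The blue neighbourhoods of \<open>x\<close> and \<open>y\<close> are disjoint
      because \<open>xy\<close> is red. Consisting of purely blue vertices, they also avoid
      \<open>u\<close> and its red neighbours.\<close>
    have "deg B x + deg B y + deg R u \<le> N"
    proof -
      let ?X = "{s. B x s}" and ?Y = "{s. B y s}" and ?U = "insert u {s. R u s}"
      have nbu: "\<not> B u s" "\<not> B s u" for s using u0 S.deg_ge1[of u s] B_sym by force+
      have 1: "?X \<inter> ?Y = {}" using cherry_nonadj[OF Rxy] B_sym by blast
      have 2: "(?X \<union> ?Y) \<inter> ?U = {}"
      proof -
        have False if "mixed R B s" "B s s'" "s' = u \<or> R u s'" for s s'
          using pureB[OF that(1,2)] that(2,3) nbu R_sym B_sym unfolding mixed_def by metis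
        then show ?thesis using x y by auto
      qed
      have "int (card (?X \<union> ?Y \<union> ?U)) = deg B x + deg B y + (deg R u + 1)"
        using 1 2 finB finR R_irrefl by (simp add: int_card_Un_disjoint deg_def)
      moreover have "?X \<union> ?Y \<union> ?U \<subseteq> V" using B_in2 R_in2 u by auto
      ultimately show ?thesis using card_le_N[of "?X \<union> ?Y \<union> ?U"] by linarith
    qed
    then show False
      by (rule red_edge_pure_nbr_arith[OF wv(2) uN uw conjunct1[OF le[OF x]] bge[OF x] star[OF x] single[OF x] single[OF y] yy])
  next
    case False
    have key: "mixed R B u \<and> deg R u + 1 \<le> 2 * deg B u \<and> N + 2 \<le> c + deg R t + deg B u + deg R u" if u: "R t u" for u
    proof -
      have mu: "mixed R B u" using False u by blast
      note tu = S.blue_edge_common[OF u, unfolded t(2)] S.no_isolated_blue_edge[OF nC4' sw[OF t(1)] sw[OF mu] u, unfolded t(2)]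
      obtain s where s: "B u s" using mu by (auto simp: mixed_def)
      have ms: "\<not> mixed R B s"
      proof
        assume ms: "mixed R B s"
        show False
          by (rule mixed_nbr_blue_arith[OF wv(3) vc rge[OF t(1)] single[OF t(1), unfolded t(2)]
            rge[OF mu] conjunct1[OF le[OF mu]] bge[OF mu] single[OF mu] tu
            bge[OF ms] lec[OF ms] star[OF ms] blue_edge_removal[OF s] blue_edge_common[OF s]
            no_isolated_blue_edge[OF nC4 mu ms s]])
      qed
      note us = pure_blue_nbr(3)[OF mu s ms nu[OF mu]]
      show ?thesis
        using mixed_nbr_common_arith[OF rge[OF t(1)] single[OF t(1), unfolded t(2)]
            rge[OF mu] lec[OF mu] single[OF mu] tu(2) us] us mu by blast
    qed
    obtain u where u: "R t u" using t by (auto simp: mixed_def)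
    note ku = key[OF u]
    then have "deg B t + deg R t + deg B u + deg R u \<ge> N + 2" using t(2) by linarith
    then obtain z where z: "R t z" "R u z" using S.blue_common[OF u] by blast
    note kz = key[OF z(1)]
    have mu: "mixed R B u" and mz: "mixed R B z" using ku kz by blast+
    have "deg B u + deg R u + c + deg B z \<le> N"
      using S.blue_triangle_nbr[OF z(1) u R_sym[OF z(2)]] t(2) by simp
    then show False
      using mixed_triangle_arith[OF wv(3) vc ca conjunct1[OF le[OF mu]] lec[OF mu] single[OF mu] star[OF mz]] kz
      by blast
  qed
qed

lemma no_mixed_edge:
  assumes nC4: "\<not> alternating_C4 V R B" and x: "mixed R B x" and y: "mixed R B y"
  shows "\<not> R x y \<and> \<not> B x y"
proof (rule ccontr)
  assume "\<not> ?thesis"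
  then have xy: "R x y \<or> B x y" by blast
  interpret S: critical V B R by (rule swap)
  have nC4': "\<not> alternating_C4 V B R" using nC4 alternating_C4_swap by metis
  note sw = mixed_swap[of B R]
  obtain a v w where le: "\<And>x. mixed R B x \<Longrightarrow> deg R x \<le> a \<and> deg B x \<le> a"
    and vw: "mixed R B v" "\<not> mixed R B w" "deg R v = a \<and> B v w \<or> deg B v = a \<and> R v w"
    using extremal_mixed[OF nC4 x] by blast
  from vw(3) show False
  proof
    assume "deg R v = a \<and> B v w"
    then show False using no_mixed_edge_oriented[OF nC4 le vw(1) _ _ vw(2) x y xy] by blast
  next
    assume "deg B v = a \<and> R v w"
    then show False using S.no_mixed_edge_oriented[OF nC4', of a v w x y] le vw x y xy unfolding sw by blast
  qed
qed

section \<open>Independent mixed vertices: counting and rigidity\<close>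

text \<open>Each blue gain is at most its value when all edges compatible with purity and
  independence are present. The total of these values is nonpositive, so criticality makes every
  estimate tight and determines all neighbourhoods.\<close>

lemma independent_mixed_structure:
  assumes indep: "\<And>x y. mixed R B x \<Longrightarrow> mixed R B y \<Longrightarrow> \<not> R x y \<and> \<not> B x y"
    and X: "X = {x. mixed R B x}"
    and F: "F = {x. (\<exists>y. R x y) \<and> \<not> mixed R B x}"
    and G: "G = {x. (\<exists>y. B x y) \<and> \<not> mixed R B x}"
    and GF: "card G \<le> card F"
  shows "V = X \<union> F \<union> G" "H_structure R B X F G" "excess B R V \<le> 0"
proof -
  interpret S: critical V B R by (rule swap)
  have sub: "X \<subseteq> V" "F \<subseteq> V" "G \<subseteq> V" using mixed_in R_in B_in by (auto simp: X F G)
  have fin': "finite X" "finite F" "finite G" using sub fin finite_subset by blast+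
  have disj: "X \<inter> F = {}" "X \<inter> G = {}" "F \<inter> G = {}" by (auto simp: X F G mixed_def)
  obtain e e' where e: "R e e'" using R_ne by blast
  have N1: "N \<ge> 1"
  proof -
    have "card {e, e'} \<le> card V" using e R_in R_in2 by (intro card_mono fin) auto
    moreover have "e \<noteq> e'" using e R_irrefl by auto
    ultimately show ?thesis by simp
  qed
  have "V \<subseteq> X \<union> F \<union> G"
  proof
    fix x assume x: "x \<in> V"
    show "x \<in> X \<union> F \<union> G"
    \<comment> \<open>A vertex without edges has both gains equal to \<open>-N\<close>, which is
      negative.\<close>
    proof (rule ccontr)
      assume "x \<notin> X \<union> F \<union> G"
      then have "deg R x = 0" "deg B x = 0" using deg_zero[of x] S.deg_zero[of x] by (auto simp: X F G)
      then show False using removal1[OF x] N1 by linarith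
    qed
  qed
  then show V: "V = X \<union> F \<union> G" using sub by blast
  have subX: "{y. R x y} \<subseteq> F" "{y. B x y} \<subseteq> G" if "x \<in> X" for x
    using that indep R_sym B_sym unfolding X F G by blast+
  have subF: "{y. R x y} \<subseteq> X \<union> (F - {x})" "{y. B x y} = {}" if "x \<in> F" for x
    using that R_sym R_irrefl unfolding X F mixed_def by blast+
  have subG: "{y. B x y} \<subseteq> X \<union> (G - {x})" "{y. R x y} = {}" if "x \<in> G" for x
    using that B_sym B_irrefl unfolding X G mixed_def by blast+
  define k f g where "k = int (card X)" and "f = int (card F)" and "g = int (card G)"
  have N: "N = k + f + g - 1"
    unfolding V k_def f_def g_def using fin' disj by (simp add: card_Un_disjoint Int_Un_distrib2)
  have cF: "int (card (X \<union> (F - {x}))) = k + f - 1" if "x \<in> F" for x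
  proof -
    have "card F \<ge> 1" using that fin'(2) card_gt_0_iff[of F] by fastforce
    moreover have "X \<inter> (F - {x}) = {}" using disj by blast
    ultimately show ?thesis using fin' that by (simp add: card_Un_disjoint k_def f_def)
  qed
  have cG: "int (card (X \<union> (G - {x}))) = k + g - 1" if "x \<in> G" for x
  proof -
    have "card G \<ge> 1" using that fin'(3) card_gt_0_iff[of G] by fastforce
    moreover have "X \<inter> (G - {x}) = {}" using disj by blast
    ultimately show ?thesis using fin' that by (simp add: card_Un_disjoint k_def g_def)
  qed
  have dX: "deg R x \<le> f" "deg B x \<le> g" if "x \<in> X" for x
    using card_mono[OF _ subX(1)[OF that]] card_mono[OF _ subX(2)[OF that]] fin'
    by (simp_all add: deg_def f_def g_def)
  have dF: "deg R x \<le> k + f - 1" "deg B x = 0" if "x \<in> F" for x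
    using card_mono[OF _ subF(1)[OF that]] subF(2)[OF that] fin' cF[OF that]
    by (simp_all add: deg_def)
  have dG: "deg B x \<le> k + g - 1" "deg R x = 0" if "x \<in> G" for x
    using card_mono[OF _ subG(1)[OF that]] subG(2)[OF that] fin' cG[OF that]
    by (simp_all add: deg_def)
  have g1: "g \<ge> 1"
  proof -
    obtain x y where xy: "B x y" using B_ne by blast
    have "x \<in> G \<or> y \<in> G" using xy indep[of x y] B_sym unfolding G by blast
    then have "G \<noteq> {}" by blast
    then show ?thesis using fin'(3) card_gt_0_iff[of G] by (simp add: g_def)
  qed
  have fg: "g \<le> f" using GF by (simp add: f_def g_def)
  \<comment> \<open>Upper bounds for the blue gains on \<open>X\<close>, \<open>F\<close> and
    \<open>G\<close>, obtained from the maximal possible degrees in each part.\<close>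
  define h where "h x = (if x \<in> X then 2 * g + f - N else if x \<in> F then k + f - 1 - N
    else 2 * (k + g - 1) - N)" for x
  have qh: "gainB x \<le> h x" if "x \<in> V" for x
  proof -
    consider "x \<in> X" | "x \<in> F" "x \<notin> X" | "x \<in> G" "x \<notin> X" "x \<notin> F" using \<open>x \<in> V\<close> V disj by blast
    then show ?thesis by cases (use dX[of x] dF[of x] dG[of x] in \<open>auto simp: h_def\<close>)
  qed
  have "sum h V = sum h X + sum h F + sum h G"
    unfolding V using fin' disj by (simp add: sum.union_disjoint Int_Un_distrib2)
  also have "sum h X = k * (2 * g + f - N)" by (simp add: h_def k_def)
  also have "sum h F = (\<Sum>x\<in>F. k + f - 1 - N)" by (rule sum.cong) (use disj in \<open>auto simp: h_def\<close>)
  also have "\<dots> = f * (k + f - 1 - N)" by (simp add: f_def)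
  also have "sum h G = (\<Sum>x\<in>G. 2 * (k + g - 1) - N)" by (rule sum.cong) (use disj in \<open>auto simp: h_def\<close>)
  also have "\<dots> = g * (2 * (k + g - 1) - N)" by (simp add: g_def)
  finally have hsum: "sum h V = - ((k - g) * (k - g - 1)) - 2 * g * (f - g)"
    unfolding N by (simp add: algebra_simps)
  have ex: "excess B R V = sum gainB V" by (rule S.excess_rows)
  have le: "sum gainB V \<le> sum h V" by (rule sum_mono) (use qh in blast)
  \<comment> \<open>A product of two consecutive integers is never negative, and it vanishes only
    for \<open>k = g\<close> or \<open>k = g + 1\<close>; this is the origin of the two
    families.\<close>
  have t: "(k - g) * (k - g - 1) \<ge> 0" by (cases "k - g \<ge> 1") (auto intro: mult_nonneg_nonneg mult_nonpos_nonpos)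
  have gf: "2 * g * (f - g) \<ge> 0" using g1 fg by simp
  show "excess B R V \<le> 0" using ex le hsum t gf by linarith
  have z: "(k - g) * (k - g - 1) = 0" "2 * g * (f - g) = 0" "sum gainB V = sum h V"
    using ex le hsum t gf exB by linarith+
  have "f = g" using z(2) g1 by auto
  have "k = g \<or> k = g + 1" using z(1) by auto
  have "sum (\<lambda>x. h x - gainB x) V = 0" using z(3) by (simp add: sum_subtractf)
  then have eq: "h x = gainB x" if "x \<in> V" for x
    using sum_nonneg_eq_0_iff[OF fin, of "\<lambda>x. h x - gainB x"] qh that by force
  have eX: "{y. R x y} = F" "{y. B x y} = G" if "x \<in> X" for x
  proof -
    have "h x = 2 * g + f - N" using that by (simp add: h_def)
    then have "deg R x = f" "deg B x = g" using eq[of x] dX[OF that] that sub by auto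
    then have "card {y. R x y} = card F" "card {y. B x y} = card G"
      by (simp_all add: deg_def f_def g_def)
    then show "{y. R x y} = F" "{y. B x y} = G"
      using card_subset_eq subX[OF that] fin' by blast+
  qed
  have eF: "{y. R x y} = X \<union> (F - {x})" if "x \<in> F" for x
  proof -
    have "h x = k + f - 1 - N" using that disj by (auto simp: h_def)
    then have "deg R x = k + f - 1" using eq[of x] dF[OF that] that sub by auto
    then have "card {y. R x y} = card (X \<union> (F - {x}))" using cF[OF that] by (simp add: deg_def)
    then show ?thesis using card_subset_eq[OF _ subF(1)[OF that]] fin' by blast
  qed
  have eG: "{y. B x y} = X \<union> (G - {x})" if "x \<in> G" for x
  proof -
    have "h x = 2 * (k + g - 1) - N" using that disj by (auto simp: h_def)
    then have "deg B x = k + g - 1" using eq[of x] dG[OF that] that sub by auto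
    then have "card {y. B x y} = card (X \<union> (G - {x}))" using cG[OF that] by (simp add: deg_def)
    then show ?thesis using card_subset_eq[OF _ subG(1)[OF that]] fin' by blast
  qed
  have R: "R x y \<longleftrightarrow> x \<in> X \<and> y \<in> F \<or> x \<in> F \<and> y \<in> X \<or> x \<in> F \<and> y \<in> F \<and> x \<noteq> y" for x y
  proof -
    consider "x \<in> X" | "x \<in> F" "x \<notin> X" | "x \<in> G" "x \<notin> X" "x \<notin> F" | "x \<notin> V" using V disj by blast
    then show ?thesis
      by cases (use eX(1)[of x] eF[of x] subG(2)[of x] R_in[of x y] sub in blast)+
  qed
  have B: "B x y \<longleftrightarrow> x \<in> X \<and> y \<in> G \<or> x \<in> G \<and> y \<in> X \<or> x \<in> G \<and> y \<in> G \<and> x \<noteq> y" for x y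
  proof -
    consider "x \<in> X" "x \<notin> G" | "x \<in> F" "x \<notin> X" "x \<notin> G" | "x \<in> G" "x \<notin> X" "x \<notin> F" | "x \<notin> V" using V disj by blast
    then show ?thesis
      by cases (use eX(2)[of x] eG[of x] subF(2)[of x] B_in[of x y] sub in blast)+
  qed
  show "H_structure R B X F G"
    unfolding H_structure_def using disj R B g1 \<open>f = g\<close> \<open>k = g \<or> k = g + 1\<close>
    by (auto simp: f_def g_def k_def)
qed

text \<open>The second conjunct closes the induction for the bound, the first yields the equality
  case. If there are more purely blue than purely red vertices, the colours are exchanged.\<close>

lemma critical_structure:
  assumes nC4: "\<not> alternating_C4 V R B"
  shows "(\<exists>X F G. V = X \<union> F \<union> G \<and> H_structure R B X F G) \<and> (excess R B V \<le> 0 \<or> excess B R V \<le> 0)"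
proof -
  interpret S: critical V B R by (rule swap)
  note indep = no_mixed_edge[OF nC4]
  let ?F = "{x. (\<exists>y. R x y) \<and> \<not> mixed R B x}" and ?G = "{x. (\<exists>y. B x y) \<and> \<not> mixed R B x}"
  show ?thesis
  proof (cases "card ?G \<le> card ?F")
    case True
    show ?thesis using independent_mixed_structure[OF indep refl refl refl True] by blast
  next
    case False
    note str = S.independent_mixed_structure[unfolded mixed_swap[of B R], OF _ refl refl refl]
    have "V = {x. mixed R B x} \<union> ?G \<union> ?F" "H_structure B R {x. mixed R B x} ?G ?F" "excess R B V \<le> 0"
      by (rule str; use indep False in simp)+
    then show ?thesis using H_structure_swap[of B R "{x. mixed R B x}" ?G ?F] by blast
  qed
qed

lemma alternating_C4_excess: "alternating_C4 V R B \<Longrightarrow> excess R B V \<le> 0"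
proof -
  assume "alternating_C4 V R B"
  then obtain a b c d where *: "distinct [a, b, c, d]" "V = {a, b, c, d}" "R a b" "B b c" "R c d" "B d a"
     "\<not> R a c" "\<not> B a c" "\<not> R b d" "\<not> B b d" unfolding alternating_C4_def by blast
  have "wt R B a b = 1" "wt R B a c = -1" "wt R B a d = 0" "wt R B b c = 0" "wt R B b d = -1" "wt R B c d = 1"
    "wt R B x x = 0" for x
    using * RB_disj R_sym B_sym R_irrefl B_irrefl unfolding wt_def by (metis distinct_length_2_or_more)+
  then show "excess R B V \<le> 0"
    using *(1) wt_sym[of b a] wt_sym[of c a] wt_sym[of d a] wt_sym[of c b] wt_sym[of d b] wt_sym[of d c]
    by (simp add: excess_def *(2))
qed
end

subsection \<open>The bound and its equality case\<close>

text \<open>The locale confines both relations to the vertex set, so an induced subgraph needs them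
  cut down to \<open>T\<close>.\<close>

lemma no_nmt_restrict:
  assumes "no_nmt V R B" "T \<subseteq> V"
  shows "no_nmt T (\<lambda>x y. R x y \<and> x \<in> T \<and> y \<in> T) (\<lambda>x y. B x y \<and> x \<in> T \<and> y \<in> T)"
proof -
  interpret no_nmt V R B by fact
  show ?thesis
  proof
    show "finite T" using fin assms finite_subset by blast
  qed (use R_sym B_sym R_irrefl B_irrefl RB_disj cherry in blast)+
qed

lemma excess_restrict:
  "excess (\<lambda>x y. R x y \<and> x \<in> T \<and> y \<in> T) (\<lambda>x y. B x y \<and> x \<in> T \<and> y \<in> T) T = excess R B T"
  unfolding excess_def by (intro sum.cong refl) (auto simp: wt_def)

lemma excess_nonpos: "(\<And>x y. \<not> R x y) \<Longrightarrow> excess R B V \<le> 0"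
  unfolding excess_def by (intro sum_nonpos) (auto simp: wt_def)

text \<open>A smallest counterexample would be critical, with both excesses positive, and every
  critical configuration has a nonpositive excess.\<close>

theorem excess_bound:
  assumes "no_nmt V R B"
  shows "excess R B V \<le> 0 \<or> excess B R V \<le> 0"
  using assms
proof (induction "card V" arbitrary: V R B rule: less_induct)
  case less
  interpret no_nmt V R B by fact
  show ?case
  proof (rule ccontr)
    assume neg: "\<not> ?case"
    have "critical V R B"
    proof
      fix T assume T: "T \<subset> V"
      then have "card T < card V" using fin psubset_card_mono by blast
      from less.hyps[OF this no_nmt_restrict[OF less.prems]] T
      show "excess R B T \<le> 0 \<or> excess B R T \<le> 0" by (auto simp: excess_restrict)
    qed (use neg excess_nonpos[of R] excess_nonpos[of B] in \<open>fastforce+\<close>)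
    then interpret critical V R B .
    show False using neg critical_structure alternating_C4_excess by blast
  qed
qed

theorem equality_structure:
  assumes "no_nmt V R B" "0 \<le> excess R B V" "0 \<le> excess B R V" "\<exists>x y. R x y" "\<exists>x y. B x y"
  shows "alternating_C4 V R B \<or> (\<exists>X F G. V = X \<union> F \<union> G \<and> H_structure R B X F G)"
proof -
  interpret no_nmt V R B by fact
  interpret critical V R B
  proof
    fix T assume T: "T \<subset> V"
    then show "excess R B T \<le> 0 \<or> excess B R T \<le> 0"
      using excess_bound[OF no_nmt_restrict[OF assms(1)], of T] by (auto simp: excess_restrict)
  qed (use assms in auto)
  show ?thesis using critical_structure by blast
qed

subsection \<open>Edge sets and isomorphisms\<close>

lemma nsets_2E: assumes "e \<in> [V]\<^bsup>2\<^esup>" obtains x y where "e = {x, y}" "x \<in> V" "y \<in> V" "x \<noteq> y"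
  using assms unfolding nsets_def by (auto simp: card_2_iff)

text \<open>Neighbours of \<open>x\<close> correspond to edges containing \<open>x\<close>, and each
  edge is counted from its two ends.\<close>

lemma handshake:
  assumes fin: "finite V" and C: "C \<subseteq> [V]\<^bsup>2\<^esup>"
  shows "(\<Sum>x\<in>V. deg (\<lambda>x y. {x, y} \<in> C) x) = 2 * int (card C)"
proof -
  have finC: "finite C" using C fin finite_imp_finite_nsets finite_subset by blast
  have "card {y. {x, y} \<in> C} = card {e \<in> C. x \<in> e}" for x
  proof (rule bij_betw_same_card)
    show "bij_betw (\<lambda>y. {x, y}) {y. {x, y} \<in> C} {e \<in> C. x \<in> e}"
    proof (rule bij_betw_imageI)
      show "inj_on (\<lambda>y. {x, y}) {y. {x, y} \<in> C}" by (auto simp: inj_on_def doubleton_eq_iff)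
      show "(\<lambda>y. {x, y}) ` {y. {x, y} \<in> C} = {e \<in> C. x \<in> e}"
      proof (intro equalityI subsetI)
        fix e assume e: "e \<in> {e \<in> C. x \<in> e}"
        then obtain a b where "e = {a, b}" using C nsets_2E by blast
        then have "\<exists>y. e = {x, y}" using e by auto
        then show "e \<in> (\<lambda>y. {x, y}) ` {y. {x, y} \<in> C}" using e by auto
      qed auto
    qed
  qed
  then have "(\<Sum>x\<in>V. deg (\<lambda>x y. {x, y} \<in> C) x) = int (\<Sum>x\<in>V. card {e \<in> C. x \<in> e})"
    by (simp add: deg_def)
  also have "(\<Sum>x\<in>V. card {e \<in> C. x \<in> e}) = 2 * card C"
  proof (rule sum_multicount[OF fin finC])
    show "\<forall>e\<in>C. card {x \<in> V. x \<in> e} = 2"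
    proof
      fix e assume "e \<in> C"
      then have "e \<subseteq> V" "card e = 2" using C by (auto simp: nsets_def)
      moreover from this have "{x \<in> V. x \<in> e} = e" by auto
      ultimately show "card {x \<in> V. x \<in> e} = 2" by simp
    qed
  qed
  finally show ?thesis by simp
qed

lemma bij_image_edges:
  assumes h: "bij_betw h V W" and C: "C \<subseteq> [V]\<^bsup>2\<^esup>" and D: "D \<subseteq> [W]\<^bsup>2\<^esup>"
    and iff: "\<And>x y. x \<in> V \<Longrightarrow> y \<in> V \<Longrightarrow> {x, y} \<in> C \<longleftrightarrow> {h x, h y} \<in> D"
  shows "(`) h ` C = D"
proof (intro equalityI subsetI)
  fix d assume "d \<in> (`) h ` C"
  then obtain e where e: "e \<in> C" "d = h ` e" by blast
  then obtain x y where "e = {x, y}" "x \<in> V" "y \<in> V" using C nsets_2E by blast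
  then show "d \<in> D" using e iff by simp
next
  fix d assume d: "d \<in> D"
  then obtain a b where ab: "d = {a, b}" "a \<in> W" "b \<in> W" using D nsets_2E by blast
  then obtain x y where xy: "x \<in> V" "y \<in> V" "a = h x" "b = h y" using h unfolding bij_betw_def by blast
  then have "{x, y} \<in> C" "d = h ` {x, y}" using iff ab d by auto
  then show "d \<in> (`) h ` C" by blast
qed

lemma H_edges_iff:
  assumes "X \<inter> F = {}" "X \<inter> G = {}" "F \<inter> G = {}"
  shows "{x, y} \<in> H_edges X F G \<longleftrightarrow>
    (x \<in> X \<and> y \<in> F \<or> x \<in> F \<and> y \<in> X \<or> x \<in> F \<and> y \<in> F \<and> x \<noteq> y) \<or>
    (x \<in> X \<and> y \<in> G \<or> x \<in> G \<and> y \<in> X \<or> x \<in> G \<and> y \<in> G \<and> x \<noteq> y)"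
  unfolding H_edges_def by (auto simp: doubleton_in_nsets_2 doubleton_eq_iff)

lemma H_edges_subset:
  assumes "X \<inter> F = {}" "X \<inter> G = {}"
  shows "H_edges X F G \<subseteq> [X \<union> F \<union> G]\<^bsup>2\<^esup>"
proof -
  have "[F]\<^bsup>2\<^esup> \<subseteq> [X \<union> F \<union> G]\<^bsup>2\<^esup>" "[G]\<^bsup>2\<^esup> \<subseteq> [X \<union> F \<union> G]\<^bsup>2\<^esup>" by (auto intro!: nsets_mono)
  then show ?thesis using assms unfolding H_edges_def by (auto simp: doubleton_in_nsets_2)
qed

text \<open>Any bijections between corresponding parts glue to an isomorphism, because adjacency and
  colour depend only on the parts of two distinct vertices.\<close>

lemma H_structure_iso:
  assumes E: "E = R \<union> B" "E \<subseteq> [V]\<^bsup>2\<^esup>" and fin: "finite V" and V: "V = X \<union> F \<union> G"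
    and str: "H_structure (\<lambda>x y. {x, y} \<in> R) (\<lambda>x y. {x, y} \<in> B) X F G"
  shows "coloured_iso (V, E, R, B) (H_on (part 0 (card X)) (part 1 (card F)) (part 2 (card F)))"
proof -
  note s = str[unfolded H_structure_def]
  have disj: "X \<inter> F = {}" "X \<inter> G = {}" "F \<inter> G = {}" and cG: "card G = card F" using s by auto
  have "\<forall>x y. {x, y} \<in> R \<longleftrightarrow> x \<in> X \<and> y \<in> F \<or> x \<in> F \<and> y \<in> X \<or> x \<in> F \<and> y \<in> F \<and> x \<noteq> y"
    using s by (elim conjE)
  note R = this[rule_format]
  have "\<forall>x y. {x, y} \<in> B \<longleftrightarrow> x \<in> X \<and> y \<in> G \<or> x \<in> G \<and> y \<in> X \<or> x \<in> G \<and> y \<in> G \<and> x \<noteq> y"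
    using s by (elim conjE)
  note B = this[rule_format]
  let ?X = "part 0 (card X)" and ?F = "part 1 (card F)" and ?G = "part 2 (card F)"
  let ?W = "?X \<union> ?F \<union> ?G" and ?E = "H_edges ?X ?F ?G"
  have disj': "?X \<inter> ?F = {}" "?X \<inter> ?G = {}" "?F \<inter> ?G = {}" by (auto simp: part_def)
  have ex: "\<exists>f. bij_betw f A (part i (card A))" if "A \<subseteq> V" for A i
    by (rule finite_same_card_bij) (use that fin finite_subset in \<open>auto simp: part_def\<close>)
  obtain h0 where h0: "bij_betw h0 X ?X" using ex[of X] V by blast
  obtain h1 where h1: "bij_betw h1 F ?F" using ex[of F] V by blast
  obtain h2 where h2: "bij_betw h2 G ?G" using ex[of G] V cG by (metis sup_ge2)
  define h where "h x = (if x \<in> X then h0 x else if x \<in> F then h1 x else h2 x)" for x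
  have hX: "bij_betw h X ?X" using h0 by (rule bij_betw_cong[THEN iffD1, rotated]) (simp add: h_def)
  have hF: "bij_betw h F ?F" using h1 by (rule bij_betw_cong[THEN iffD1, rotated]) (use disj in \<open>auto simp: h_def\<close>)
  have hG: "bij_betw h G ?G" using h2 by (rule bij_betw_cong[THEN iffD1, rotated]) (use disj in \<open>auto simp: h_def\<close>)
  have h: "bij_betw h V ?W" unfolding V
    by (intro bij_betw_combine hX hF hG) (use disj' in auto)
  have mem: "h x \<in> ?X \<longleftrightarrow> x \<in> X" "h x \<in> ?F \<longleftrightarrow> x \<in> F" "h x \<in> ?G \<longleftrightarrow> x \<in> G" if "x \<in> V" for x
  proof -
    have "x \<in> X \<Longrightarrow> h x \<in> ?X" "x \<in> F \<Longrightarrow> h x \<in> ?F" "x \<in> G \<Longrightarrow> h x \<in> ?G"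
      using hX hF hG bij_betwE by blast+
    then show "h x \<in> ?X \<longleftrightarrow> x \<in> X" "h x \<in> ?F \<longleftrightarrow> x \<in> F" "h x \<in> ?G \<longleftrightarrow> x \<in> G"
      using that disj disj' V by blast+
  qed
  have inj: "h x = h y \<longleftrightarrow> x = y" if "x \<in> V" "y \<in> V" for x y
    using h that unfolding bij_betw_def by (meson inj_on_eq_iff)
  have Eh: "{h x, h y} \<in> ?E \<longleftrightarrow> {x, y} \<in> E" if "x \<in> V" "y \<in> V" for x y
    unfolding H_edges_iff[OF disj'] E(1) Un_iff R B using mem inj that by simp
  \<comment> \<open>An edge is red exactly when it meets \<open>F\<close>, since \<open>F\<close>
    and \<open>G\<close> are not joined and \<open>X\<close> is independent.\<close>
  have Rh: "{x, y} \<in> R \<longleftrightarrow> {h x, h y} \<in> incident_edges ?E ?F" if "x \<in> V" "y \<in> V" for x y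
    unfolding incident_edges_def using Eh[OF that] mem[OF that(1)] mem[OF that(2)] disj
    by (auto simp: E(1) R B)
  have Bh: "{x, y} \<in> B \<longleftrightarrow> {h x, h y} \<in> incident_edges ?E ?G" if "x \<in> V" "y \<in> V" for x y
    unfolding incident_edges_def using Eh[OF that] mem[OF that(1)] mem[OF that(2)] disj
    by (auto simp: E(1) R B)
  have sub: "incident_edges ?E A \<subseteq> [?W]\<^bsup>2\<^esup>" for A
    using H_edges_subset[OF disj'(1,2)] by (auto simp: incident_edges_def)
  have "(`) h ` R = incident_edges ?E ?F" "(`) h ` B = incident_edges ?E ?G"
    by (rule bij_image_edges[OF h _ sub]; use E Rh Bh in blast)+
  then show ?thesis unfolding H_on_def coloured_iso.simps
    by (intro exI[of _ h] conjI ballI disjI1) (simp_all only: h Eh)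
qed

lemma alternating_C4_matchings:
  assumes E: "E = R \<union> B" "E \<subseteq> [V]\<^bsup>2\<^esup>"
    and C4: "alternating_C4 V (\<lambda>x y. {x, y} \<in> R) (\<lambda>x y. {x, y} \<in> B)" and RB: "R \<inter> B = {}"
  shows "four_cycle V E \<and> perfect_matching V E R \<and> perfect_matching V E B"
proof -
  obtain a b c d where d: "distinct [a, b, c, d]" and V: "V = {a, b, c, d}"
    and e: "{a, b} \<in> R" "{b, c} \<in> B" "{c, d} \<in> R" "{d, a} \<in> B"
    and n: "{a, c} \<notin> R" "{a, c} \<notin> B" "{b, d} \<notin> R" "{b, d} \<notin> B"
    using C4 unfolding alternating_C4_def by blast
  have sub: "e \<in> {{a, b}, {b, c}, {c, d}, {d, a}}" if "e \<in> E" for e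
  proof -
    obtain x y where "e = {x, y}" "x \<in> V" "y \<in> V" "x \<noteq> y" using \<open>e \<in> E\<close> E(2) nsets_2E by blast
    then show ?thesis using that n unfolding V E(1) by (auto simp: insert_commute)
  qed
  have R: "R = {{a, b}, {c, d}}" using sub e RB unfolding E(1) by blast
  have B: "B = {{b, c}, {d, a}}" using sub e RB unfolding E(1) by blast
  have "E = {{a, b}, {b, c}, {c, d}, {d, a}}" unfolding E(1) R B by auto
  then have "four_cycle V E" unfolding four_cycle_def using d V by blast
  moreover have "perfect_matching V E R" "perfect_matching V E B"
    unfolding perfect_matching_def E(1) V using d by (auto simp: R B)
  ultimately show ?thesis by blast
qed

section \<open>Translation between edge sets and colour relations\<close>

theorem theorem2p2:
  fixes V :: "'a set" and E R B :: "'a set set"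
  assumes "finite_simple_graph V E"
    and "E = R \<union> B" and "R \<inter> B = {}"
    and "card E + min (card R) (card B) \<ge> card V choose 2"
  shows "non_monochromatic_triangle V E R B
    \<or> (complete_graph V E \<and> (E = R \<or> E = B))
    \<or> (four_cycle V E \<and> perfect_matching V E R \<and> perfect_matching V E B)
    \<or> (\<exists>m\<ge>1. coloured_iso (V, E, R, B) (H_graph m) \<or>
              coloured_iso (V, E, R, B) (H_plus_graph m))"
proof (cases "non_monochromatic_triangle V E R B \<or> R = {} \<or> B = {}")
  case True
  have fin: "finite V" and E: "E \<subseteq> [V]\<^bsup>2\<^esup>" using assms(1) by (auto simp: finite_simple_graph_def)
  \<comment> \<open>With an empty colour class the minimum is 0, and the hypothesis says that no
    pair is missing.\<close>
  have "complete_graph V E" if "R = {} \<or> B = {}"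
  proof -
    have "card E \<ge> card ([V]\<^bsup>2\<^esup>)" using that assms(4) by (auto simp: card_nsets)
    then show ?thesis unfolding complete_graph_def
      using E card_seteq[OF finite_imp_finite_nsets[OF fin]] by blast
  qed
  then show ?thesis using True assms(2) by auto
next
  case False
  have fin: "finite V" and E: "E \<subseteq> [V]\<^bsup>2\<^esup>" using assms(1) by (auto simp: finite_simple_graph_def)
  have sub: "R \<subseteq> [V]\<^bsup>2\<^esup>" "B \<subseteq> [V]\<^bsup>2\<^esup>" using E assms(2) by auto
  let ?R = "\<lambda>x y. {x, y} \<in> R" and ?B = "\<lambda>x y. {x, y} \<in> B"
  have edge: "x \<in> V \<and> y \<in> V \<and> x \<noteq> y" if "{x, y} \<in> E" for x y
    using that E doubleton_in_nsets_2[of x y V] by blast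
  have loop: "{x} \<notin> R" "{x} \<notin> B" for x using edge[of x x] assms(2) by auto
  interpret no_nmt V ?R ?B
  proof
    fix x y z assume xy: "{x, y} \<in> R" and yz: "{y, z} \<in> B"
    have "{x, z} \<notin> E"
    proof
      assume "{x, z} \<in> E"
      then have "x \<in> V" "y \<in> V" "z \<in> V" "distinct [x, y, z]" "{{x, y}, {y, z}, {x, z}} \<subseteq> E"
        using xy yz assms(2) edge[of x y] edge[of y z] edge[of x z] by auto
      then have "non_monochromatic_triangle V E R B"
        unfolding non_monochromatic_triangle_def using xy yz by blast
      then show False using False by blast
    qed
    then show "{x, z} \<notin> R \<and> {x, z} \<notin> B" using assms(2) by blast
  qed (use fin edge loop assms(2,3) in \<open>auto simp: insert_commute\<close>)
  interpret S: no_nmt V ?B ?R by (rule swap_no_nmt)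
  have finE: "finite R" "finite B" using sub fin finite_imp_finite_nsets finite_subset by blast+
  have cE: "card E = card R + card B" using finE assms(2,3) by (simp add: card_Un_disjoint)
  have "2 * (card V choose 2) = card V * (card V - 1)"
    unfolding choose_two by (rule dvd_mult_div_cancel) (cases "card V"; simp)
  then have "2 * int (card V choose 2) = int (card V * (card V - 1))" by linarith
  \<comment> \<open>For empty \<open>V\<close> the integer \<open>N\<close> is -1 while natural
    subtraction gives 0; the factor \<open>card V\<close> makes both products vanish.\<close>
  then have ch: "int (card V) * N = 2 * int (card V choose 2)"
    by (cases "card V") (simp_all add: algebra_simps)
  \<comment> \<open>Summing the row formula with the handshake identity turns the hypothesis into
    nonnegativity of both excesses.\<close>
  have "excess ?R ?B V = 4 * int (card R) + 2 * int (card B) - int (card V) * N"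
    unfolding excess_rows by (simp add: sum.distrib sum_subtractf handshake[OF fin] sub flip: sum_distrib_left)
  moreover have "excess ?B ?R V = 4 * int (card B) + 2 * int (card R) - int (card V) * N"
    unfolding S.excess_rows by (simp add: sum.distrib sum_subtractf handshake[OF fin] sub flip: sum_distrib_left)
  ultimately have ex: "0 \<le> excess ?R ?B V" "0 \<le> excess ?B ?R V" using assms(4) cE ch by auto
  have ne: "\<exists>x y. {x, y} \<in> C" if "C \<noteq> {}" "C \<subseteq> [V]\<^bsup>2\<^esup>" for C
    using that nsets_2E by (metis ex_in_conv subsetD)
  from equality_structure[OF no_nmt_axioms ex ne[OF _ sub(1)] ne[OF _ sub(2)]] False
  consider "alternating_C4 V ?R ?B" | X F G where "V = X \<union> F \<union> G" "H_structure ?R ?B X F G" by blast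
  then show ?thesis
  proof cases
    case 1
    then show ?thesis using alternating_C4_matchings[OF assms(2) E _ assms(3)] by blast
  next
    case 2
    have "card F \<ge> 1" "card X = card F \<or> card X = card F + 1" using 2(2) by (auto simp: H_structure_def)
    then show ?thesis using H_structure_iso[OF assms(2) E fin 2]
      unfolding H_graph_def H_plus_graph_def by metis
  qed
qed

end
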